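(* Let $n,m$ be positive integers, $\gamma>0$, $\rho\ge 0$, $0<\varepsilon<1$ and $t$ a positive integer. For $j=1,2,\ldots$ let $f_j:[m]\to\mathcal{S}^{n\times n}$ satisfy $\|f_j(i)\|\le\gamma$ for all $i\in[m]$. Suppose that there exist independent random variables $X_1,X_2,\ldots$ taking values in $[m]$ such that $\mathbb{E}\,f_j(X_j)=\mathbf{0}$ and $\|\mathbb{E}\,f_j(X_j)^2\|\le\rho^2$ for every $j$. Set $\theta=\varepsilon/\gamma$ and define indices $x_1^*,\ldots,x_t^*\in[m]$ greedily: for $i=1,\ldots,t$, let $x_i^*$ be any minimizer over $k\in[m]$ of $$\operatorname{tr}\Big(\cosh\Big(\theta\sum_{j=1}^{i-1}f_j(x_j^* )+\theta f_i(k)\Big)\Big).$$ Then $$\Big\|\frac1t\sum_{j=1}^t f_j(x_j^* )\Big\|\le\frac{\gamma\ln(2n)}{t\varepsilon}+\frac{\varepsilon\rho^2}{\gamma}.$$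
   Context: $\mathcal{S}^{n\times n}$ denotes the set of real symmetric $n\times n$ matrices and $\|\cdot\|$ the operator (spectral) norm. For a symmetric matrix $A$, $\exp(A)=\mathbf{I}+\sum_{k\ge1}A^k/k!$ is the matrix exponential and $\cosh(A)=(\exp(A)+\exp(-A))/2$ is the matrix hyperbolic cosine; $\operatorname{tr}$ is the trace. $[m]=\{1,\ldots,m\}$. *)

theory Defs
  imports "HOL-Probability.Probability"
begin

text \<open>
  On \<open>real ^ 'n ^ 'n\<close> the type-class operations are entrywise: \<open>A * B\<close> and \<open>A ^ k\<close> act on
  entries, and \<open>norm A\<close> is the Frobenius norm.  Matrix powers and the spectral norm are therefore
  introduced here on top of \<open>(**)\<close> and \<open>onorm\<close>.
\<close>

abbreviation opnorm :: "real ^ 'n ^ 'n \<Rightarrow> real" where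
  "opnorm A \<equiv> onorm ((*v) A)"

definition symmetric_mats :: "(real ^ 'n ^ 'n) set" where
  "symmetric_mats = {A. transpose A = A}"

primrec mat_power :: "real ^ 'n ^ 'n \<Rightarrow> nat \<Rightarrow> real ^ 'n ^ 'n" where
  "mat_power A 0 = mat 1"
| "mat_power A (Suc k) = A ** mat_power A k"

text \<open>The series below converges for every \<open>A\<close>; its \<open>k = 0\<close> term is the identity matrix.\<close>

definition mat_exp :: "real ^ 'n ^ 'n \<Rightarrow> real ^ 'n ^ 'n" where
  "mat_exp A = (\<Sum>k. (1 / fact k) *\<^sub>R mat_power A k)"

definition mat_cosh :: "real ^ 'n ^ 'n \<Rightarrow> real ^ 'n ^ 'n" where
  "mat_cosh A = (1 / 2) *\<^sub>R (mat_exp A + mat_exp (- A))"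

end

theory Submission
  imports Defs
begin

text \<open>
  Write \<open>A = \<Sum> a\<^sub>i u\<^sub>i u\<^sub>i\<^sup>T\<close> and \<open>A + B = \<Sum> c\<^sub>j w\<^sub>j w\<^sub>j\<^sup>T\<close>, where \<open>B\<close> is a contraction.  A difference
  \<open>c\<^sub>j - a\<^sub>i\<close> times \<open>u\<^sub>i \<bullet> w\<^sub>j\<close> is \<open>u\<^sub>i \<bullet> B w\<^sub>j\<close>, so scalar inequalities between \<open>cosh a\<close> and
  \<open>cosh c\<close>, summed over both eigenbases, become trace inequalities.  One gives
  \<open>tr cosh (A + B) \<le> tr cosh A + tr (B sinh A) + (2 tr (B\<^sup>2 cosh A) + tr (B\<^sup>2 cosh (A + B))) / 6\<close>,
  another gives \<open>tr (B\<^sup>2 cosh (A + B)) \<le> 3 tr (B\<^sup>2 cosh A)\<close>.  Together they replace the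
  Golden--Thompson inequality: for random \<open>B\<close> of mean zero,
  \<open>E tr cosh (A + B) \<le> (1 + \<parallel>E B\<^sup>2\<parallel>) tr cosh A\<close>.  A greedy choice does at least as well as
  the average, so \<open>tr cosh\<close> grows in each step by a factor of at most \<open>1 + \<theta>\<^sup>2\<rho>\<^sup>2\<close>, while
  \<open>exp \<parallel>S\<parallel> \<le> 2 tr cosh S\<close>.
\<close>

section \<open>Scalar inequalities for \<open>exp\<close> and \<open>cosh\<close>\<close>

text \<open>The factor \<open>(2 + exp d) / 6\<close> arises from the integral of
  \<open>(1 - s) * exp (s * d)\<close> over \<open>0 \<le> s \<le> 1\<close>, the Taylor remainder,
  with \<open>exp (s * d)\<close> replaced by its chord \<open>(1 - s) + s * exp d\<close>. The
  remainder thus involves the end points only, so that each term can later be attached to one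
  eigenvalue.\<close>

lemma exp_taylor_bound:
  fixes d :: real
  shows "exp d \<le> 1 + d + d\<^sup>2 * (2 + exp d) / 6"
proof -
  define f where "f d = 1 + d + d\<^sup>2 * (2 + exp d) / 6 - exp d" for d :: real
  define f' where "f' d = 1 + 2 * d / 3 + (d\<^sup>2 + 2 * d) * exp d / 6 - exp d" for d :: real
  define f'' where "f'' d = 2 / 3 + (d\<^sup>2 + 4 * d - 4) * exp d / 6" for d :: real
  have 1: "(f has_real_derivative f' x) (at x)" for x
    unfolding f_def f'_def by (auto intro!: derivative_eq_intros simp: field_simps power2_eq_square)
  have 2: "(f' has_real_derivative f'' x) (at x)" for x
    unfolding f'_def f''_def by (auto intro!: derivative_eq_intros simp: field_simps power2_eq_square)
  have 3: "f'' x \<ge> 0" for x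
  proof -
    \<comment> \<open>After multiplication by \<open>exp x\<close> this is the nonnegativity of
      \<open>f''\<close>.\<close>
    have "4 - 4 * x - x\<^sup>2 \<le> 4 * exp (- x)"
      using exp_ge_add_one_self[of "-x"] zero_le_power2[of x] by linarith
    then have "(4 - 4 * x - x\<^sup>2) * exp x \<le> 4 * exp (- x) * exp x"
      by (intro mult_right_mono) auto
    also have "\<dots> = 4"
      by (simp add: exp_minus)
    finally show ?thesis
      by (simp add: f''_def field_simps)
  qed
  have "convex_on UNIV f"
    by (rule f''_ge0_imp_convex[OF _ 1 2 3]) auto
  \<comment> \<open>Both \<open>f 0\<close> and \<open>f' 0\<close> vanish, so the tangent at 0 is
    the zero line.\<close>
  then have "f d - f 0 \<ge> f' 0 * (d - 0)"
    by (rule convex_on_imp_above_tangent) (auto intro: 1)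
  then show ?thesis
    by (simp add: f_def f'_def)
qed

text \<open>The bound for \<open>exp\<close>, scaled by \<open>exp a\<close>, is averaged over the
  pairs \<open>(a, c)\<close> and \<open>(-a, -c)\<close>; the sign change of \<open>c - a\<close>
  turns the linear term into \<open>sinh\<close>.\<close>

lemma cosh_taylor_bound:
  fixes a c :: real
  shows "cosh c \<le> cosh a + (c - a) * sinh a + (c - a)\<^sup>2 * (2 * cosh a + cosh c) / 6"
proof -
  have e: "exp c \<le> exp a + (c - a) * exp a + (c - a)\<^sup>2 * (2 * exp a + exp c) / 6" for a c :: real
  proof -
    have "exp a * exp (c - a) \<le> exp a * (1 + (c - a) + (c - a)\<^sup>2 * (2 + exp (c - a)) / 6)"
      by (intro mult_left_mono exp_taylor_bound) auto
    moreover have "exp a * exp (c - a) = exp c"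
      by (simp add: exp_diff)
    moreover have "exp a * (1 + (c - a) + (c - a)\<^sup>2 * (2 + exp (c - a)) / 6)
      = exp a + (c - a) * exp a + (c - a)\<^sup>2 * (2 * exp a + exp a * exp (c - a)) / 6"
      by (simp add: field_simps)
    ultimately show ?thesis
      by simp
  qed
  have "(- c - - a)\<^sup>2 = (c - a)\<^sup>2"
    by (simp add: power2_eq_square algebra_simps)
  with e[of c a] e[of "-c" "-a"] show ?thesis
    unfolding cosh_field_def sinh_field_def by (simp add: field_simps)
qed

text \<open>The trapezoid rule overestimates the integral of the convex function \<open>exp\<close>.
  The two exponentials in \<open>cosh\<close> are treated separately.\<close>

lemma abs_cosh_diff_le:
  fixes a c :: real
  shows "\<bar>cosh c - cosh a\<bar> \<le> \<bar>c - a\<bar> * (cosh a + cosh c) / 2"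
proof -
  have 0: "exp d - 1 \<le> d * (1 + exp d) / 2" if "d \<ge> 0" for d :: real
  proof -
    define f where "f d = d * (1 + exp d) / 2 - exp d" for d :: real
    have "f 0 \<le> f d"
    proof (rule DERIV_nonneg_imp_nondecreasing[OF that])
      fix x :: real
      have "(f has_real_derivative 1 / 2 + exp x * (x - 1) / 2) (at x)"
        unfolding f_def by (auto intro!: derivative_eq_intros simp: field_simps)
      moreover have "(1 - x) * exp x \<le> exp (- x) * exp x"
        using exp_ge_add_one_self[of "-x"] by (intro mult_right_mono) auto
      ultimately show "\<exists>y. (f has_real_derivative y) (at x) \<and> 0 \<le> y"
        by (intro exI[of _ "1 / 2 + exp x * (x - 1) / 2"]) (auto simp: exp_minus field_simps)
    qed
    then show ?thesis
      by (simp add: f_def)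
  qed
  have 1: "exp c - exp a \<le> (c - a) * (exp a + exp c) / 2" if "a \<le> c" for a c :: real
  proof -
    have "exp a * (exp (c - a) - 1) \<le> exp a * ((c - a) * (1 + exp (c - a)) / 2)"
      using 0[of "c - a"] that by (intro mult_left_mono) auto
    moreover have "exp a * exp (c - a) = exp c"
      by (simp add: exp_diff)
    ultimately show ?thesis
      by (simp add: algebra_simps)
  qed
  have 2: "\<bar>exp c - exp a\<bar> \<le> \<bar>c - a\<bar> * (exp a + exp c) / 2" for a c :: real
    using 1[of a c] 1[of c a] by (cases "a \<le> c") (auto simp: abs_if add.commute)
  have "\<bar>cosh c - cosh a\<bar> \<le> (\<bar>exp c - exp a\<bar> + \<bar>exp (- c) - exp (- a)\<bar>) / 2"
    unfolding cosh_field_def diff_divide_distrib[symmetric] abs_divide by simp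
  also have "\<dots> \<le> (\<bar>c - a\<bar> * (exp a + exp c) / 2 + \<bar>c - a\<bar> * (exp (- a) + exp (- c)) / 2) / 2"
    using 2[of c a] 2[of "-c" "-a"] by (simp add: abs_minus_commute)
  also have "\<dots> = \<bar>c - a\<bar> * (cosh a + cosh c) / 2"
    unfolding cosh_field_def by (simp add: field_simps)
  finally show ?thesis .
qed

section \<open>Symmetric matrices and the spectral theorem\<close>

lemma symmetric_mats_add: "A \<in> symmetric_mats \<Longrightarrow> B \<in> symmetric_mats \<Longrightarrow> A + B \<in> symmetric_mats"
  by (simp add: symmetric_mats_def transpose_def vec_eq_iff)

lemma symmetric_mats_scaleR: "A \<in> symmetric_mats \<Longrightarrow> r *\<^sub>R A \<in> symmetric_mats"
  by (simp add: symmetric_mats_def transpose_def vec_eq_iff)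

lemma symmetric_mats_sum: "(\<And>i. i \<in> I \<Longrightarrow> A i \<in> symmetric_mats) \<Longrightarrow> sum A I \<in> symmetric_mats"
  by (induction I rule: infinite_finite_induct)
    (simp_all add: symmetric_mats_add, simp_all add: symmetric_mats_def transpose_def vec_eq_iff)

lemma symmetric_mats_inner:
  fixes A :: "real ^ 'n ^ 'n"
  assumes "A \<in> symmetric_mats"
  shows "x \<bullet> (A *v y) = (A *v x) \<bullet> y"
  using assms dot_lmul_matrix[of x A y] by (simp add: symmetric_mats_def transpose_matrix_vector[symmetric] del: transpose_matrix_vector)

text \<open>A maximizer \<open>v\<close> of the quadratic form on the unit sphere of
  \<open>S\<close> is an eigenvector: otherwise a small move along the residual
  \<open>l *\<^sub>R v - A *v v\<close> would increase the Rayleigh quotient.\<close>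

lemma symmetric_eigenvector_in_subspace:
  fixes A :: "real ^ 'n ^ 'n"
  assumes A: "A \<in> symmetric_mats" and S: "subspace S" and inv: "\<And>x. x \<in> S \<Longrightarrow> A *v x \<in> S"
    and ne: "S \<noteq> {0}"
  obtains v l where "v \<in> S" "norm v = 1" "A *v v = l *\<^sub>R v"
proof -
  obtain y where y: "y \<in> S" "y \<noteq> 0"
    using ne S subspace_0 by blast
  have "compact (S \<inter> sphere 0 1)"
    using closed_subspace[OF S] by (simp add: closed_Int_compact)
  moreover have "y /\<^sub>R norm y \<in> S \<inter> sphere 0 1"
    using y S by (simp add: subspace_scale)
  then have "S \<inter> sphere 0 1 \<noteq> {}"
    by blast
  moreover have "continuous_on (S \<inter> sphere 0 1) (\<lambda>x. x \<bullet> (A *v x))"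
    by (intro continuous_intros linear_continuous_on matrix_vector_mul_bounded_linear)
  ultimately have "\<exists>v\<in>S \<inter> sphere 0 1. \<forall>x\<in>S \<inter> sphere 0 1. x \<bullet> (A *v x) \<le> v \<bullet> (A *v v)"
    by (rule continuous_attains_sup)
  then obtain v where v: "v \<in> S \<inter> sphere 0 1"
    and max: "\<And>x. x \<in> S \<inter> sphere 0 1 \<Longrightarrow> x \<bullet> (A *v x) \<le> v \<bullet> (A *v v)"
    by blast
  define l where "l = v \<bullet> (A *v v)"
  have vv: "v \<bullet> v = 1" "v \<in> S" "norm v = 1"
    using v by (auto simp: norm_eq_1)
  have q: "x \<bullet> (A *v x) \<le> l * (x \<bullet> x)" if "x \<in> S" for x
  proof (cases "x = 0")
    case False
    have "(x /\<^sub>R norm x) \<bullet> (A *v (x /\<^sub>R norm x)) \<le> l"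
      unfolding l_def using that False S by (intro max) (simp add: subspace_scale)
    then show ?thesis
      using False by (simp add: matrix_vector_mult_scaleR divide_simps dot_square_norm power2_eq_square)
  qed simp
  define w where "w = l *\<^sub>R v - A *v v"
  have wS: "w \<in> S"
    unfolding w_def using vv S by (intro subspace_diff subspace_scale inv)
  define k where "k = l * (w \<bullet> w) - w \<bullet> (A *v w)"
  \<comment> \<open>This is the maximality inequality \<open>q\<close> at
    \<open>v + s *\<^sub>R w\<close>, where the terms of order zero cancel.\<close>
  have *: "0 \<le> 2 * s * (w \<bullet> w) + s\<^sup>2 * k" for s
  proof -
    have "w \<bullet> (A *v v) = (A *v w) \<bullet> v"
      by (rule symmetric_mats_inner[OF A])
    moreover have "w \<bullet> w = l * (w \<bullet> v) - w \<bullet> (A *v v)"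
      by (simp add: w_def inner_diff_right inner_diff_left)
    then have "s * (w \<bullet> w) = s * l * (w \<bullet> v) - s * (w \<bullet> (A *v v))"
      by (simp add: right_diff_distrib)
    moreover have "v + s *\<^sub>R w \<in> S"
      using vv wS S by (intro subspace_add subspace_scale)
    note q[OF this]
    ultimately show ?thesis
      using vv unfolding k_def
      by (simp add: matrix_vector_right_distrib matrix_vector_mult_scaleR inner_add_left inner_add_right
          l_def[symmetric] algebra_simps power2_eq_square inner_commute)
  qed
  have "w \<bullet> w = 0"
  proof (rule ccontr)
    assume "w \<bullet> w \<noteq> 0"
    then have p: "w \<bullet> w > 0"
      by simp
    \<comment> \<open>Negative, and small enough that \<open>s * k\<close> cannot outweigh
      \<open>2 * (w \<bullet> w)\<close>.\<close>
    define s where "s = - (w \<bullet> w) / (\<bar>k\<bar> + 1)"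
    have "s < 0"
      using p by (simp add: s_def divide_neg_pos)
    have "s * (2 * (w \<bullet> w) + s * k) \<ge> 0"
      using *[of s] by (simp add: algebra_simps power2_eq_square)
    then have "2 * (w \<bullet> w) + s * k \<le> 0"
      using \<open>s < 0\<close> by (simp add: zero_le_mult_iff)
    moreover have "s * k \<ge> - (w \<bullet> w)"
    proof -
      have "(w \<bullet> w) * k \<le> (w \<bullet> w) * (\<bar>k\<bar> + 1)"
        using p by (intro mult_left_mono) auto
      then show ?thesis
        by (simp add: s_def field_simps)
    qed
    ultimately show False
      using p by linarith
  qed
  then show ?thesis
    using that[of v l] vv by (simp add: w_def)
qed

text \<open>Induction on the dimension: one eigenvector \<open>v\<close> is split off, and its
  orthogonal complement in \<open>S\<close> is again invariant because \<open>A\<close> is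
  self-adjoint. Invariant subspaces, not just the whole space, are what the induction needs.\<close>

lemma symmetric_orthonormal_eigenvectors_in_subspace:
  fixes A :: "real ^ 'n ^ 'n"
  assumes A: "A \<in> symmetric_mats"
  shows "\<lbrakk>subspace S; \<And>x. x \<in> S \<Longrightarrow> A *v x \<in> S\<rbrakk> \<Longrightarrow>
    \<exists>E. pairwise orthogonal E \<and> (\<forall>v\<in>E. norm v = 1 \<and> (\<exists>l. A *v v = l *\<^sub>R v)) \<and> E \<subseteq> S \<and> card E = dim S \<and> finite E"
proof (induction "dim S" arbitrary: S rule: less_induct)
  case less
  show ?case
  proof (cases "S = {0}")
    case True
    then show ?thesis
      by (intro exI[of _ "{}"]) auto
  next
    case False
    then obtain v l where v: "v \<in> S" "norm v = 1" "A *v v = l *\<^sub>R v"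
      using symmetric_eigenvector_in_subspace[OF A less.prems] by metis
    define T where "T = {x \<in> S. orthogonal v x}"
    have T: "subspace T"
      using less.prems(1) subspace_orthogonal_to_vector[of v]
      unfolding T_def Collect_conj_eq by (simp add: subspace_inter)
    have Tinv: "A *v x \<in> T" if "x \<in> T" for x
      using that less.prems(2) v symmetric_mats_inner[OF A, of v x]
      by (auto simp: T_def orthogonal_def)
    have "S = span (insert v T)"
    proof
      show "S \<subseteq> span (insert v T)"
      proof
        fix x assume x: "x \<in> S"
        have "x - (v \<bullet> x) *\<^sub>R v \<in> T"
          using x v less.prems(1)
          by (auto simp: T_def orthogonal_def inner_diff_right subspace_diff subspace_scale norm_eq_1)
        then have "(v \<bullet> x) *\<^sub>R v + (x - (v \<bullet> x) *\<^sub>R v) \<in> span (insert v T)"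
          by (intro span_add span_scale span_base) auto
        then show "x \<in> span (insert v T)"
          by simp
      qed
      show "span (insert v T) \<subseteq> S"
        using v less.prems(1) by (intro span_minimal) (auto simp: T_def)
    qed
    moreover have "v \<notin> span T"
      using v T by (auto simp: span_eq_iff[THEN iffD2] T_def orthogonal_def)
    ultimately have d: "dim S = Suc (dim T)"
      by (metis dim_insert dim_span Suc_eq_plus1)
    obtain E where E: "pairwise orthogonal E" "\<forall>v\<in>E. norm v = 1 \<and> (\<exists>l. A *v v = l *\<^sub>R v)"
      "E \<subseteq> T" "card E = dim T" "finite E"
      using less.hyps[OF _ T Tinv] d by auto
    have "v \<notin> E"
      using E(3) v by (auto simp: T_def orthogonal_def)
    have "pairwise orthogonal (insert v E)"
      using E(1,3) by (auto simp: pairwise_insert T_def orthogonal_commute)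
    moreover have "card (insert v E) = dim S" "finite (insert v E)" "insert v E \<subseteq> S"
      using E(3-5) \<open>v \<notin> E\<close> v(1) d by (auto simp: T_def)
    moreover have "\<forall>w\<in>insert v E. norm w = 1 \<and> (\<exists>l. A *v w = l *\<^sub>R w)"
      using E(2) v(2,3) by blast
    ultimately show ?thesis
      by blast
  qed
qed

text \<open>Indexing by \<open>'n\<close> itself fixes the number of vectors, so orthonormality
  already makes them a basis. Eigenvalues are repeated according to multiplicity.\<close>

definition eigenbasis :: "real ^ 'n ^ 'n \<Rightarrow> ('n \<Rightarrow> real ^ 'n) \<Rightarrow> ('n \<Rightarrow> real) \<Rightarrow> bool" where
  "eigenbasis A u a \<longleftrightarrow>
     (\<forall>i j. u i \<bullet> u j = (if i = j then 1 else 0)) \<and> (\<forall>i. A *v u i = a i *\<^sub>R u i)"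

theorem symmetric_mats_eigenbasis:
  fixes A :: "real ^ 'n ^ 'n"
  assumes A: "A \<in> symmetric_mats"
  obtains u a where "eigenbasis A u a"
proof -
  obtain E where E: "pairwise orthogonal E" "\<forall>v\<in>E. norm v = 1 \<and> (\<exists>l. A *v v = l *\<^sub>R v)"
      "card E = CARD('n)" "finite E"
    using symmetric_orthonormal_eigenvectors_in_subspace[OF A, of UNIV] by auto
  then obtain u where u: "bij_betw u (UNIV :: 'n set) E"
    by (metis finite_class.finite_UNIV finite_same_card_bij)
  then have uE: "u i \<in> E" for i
    by (auto simp: bij_betw_def)
  have "\<exists>l. A *v u i = l *\<^sub>R u i" for i
    using E(2) uE by blast
  then obtain a where a: "\<And>i. A *v u i = a i *\<^sub>R u i"
    by metis
  have "u i \<bullet> u j = (if i = j then 1 else 0)" for i j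
  proof (cases "i = j")
    case True
    then show ?thesis using E(2) uE[of j] by (simp add: norm_eq_1)
  next
    case False
    then have "u i \<noteq> u j"
      using u by (auto simp: bij_betw_def inj_on_def)
    then show ?thesis
      using False E(1) uE by (auto simp: pairwise_def orthogonal_def)
  qed
  then have "eigenbasis A u a"
    using a by (simp add: eigenbasis_def)
  then show ?thesis by (rule that)
qed

text \<open>The square matrix with rows \<open>u i\<close> has its transpose as right inverse, hence
  also as left inverse, and so preserves inner products.\<close>

lemma eigenbasis_parseval:
  fixes A :: "real ^ 'n ^ 'n"
  assumes "eigenbasis A u a"
  shows "(\<Sum>i\<in>UNIV. (x \<bullet> u i) * (u i \<bullet> y)) = x \<bullet> y"
proof -
  define U :: "real ^ 'n ^ 'n" where "U = (\<chi> i. u i)"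
  have "(U ** transpose U) $ i $ j = u i \<bullet> u j" for i j
    by (simp add: U_def matrix_matrix_mult_def transpose_def inner_vec_def)
  then have "U ** transpose U = mat 1"
    using assms by (simp add: mat_def vec_eq_iff eigenbasis_def)
  then have "transpose U ** U = mat 1"
    using matrix_left_right_inverse by blast
  then have "x \<bullet> y = x \<bullet> (transpose U *v (U *v y))"
    by (simp add: matrix_vector_mul_assoc)
  also have "\<dots> = (U *v x) \<bullet> (U *v y)"
    by (metis dot_lmul_matrix inner_commute transpose_matrix_vector)
  also have "\<dots> = (\<Sum>i\<in>UNIV. (x \<bullet> u i) * (u i \<bullet> y))"
  proof -
    have "(U *v z) $ i = u i \<bullet> z" for z i
      by (simp add: U_def matrix_vector_mult_def inner_vec_def)
    then show ?thesis
      by (simp add: inner_vec_def[of "U *v x"] inner_commute)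
  qed
  finally show ?thesis by simp
qed

lemma eigenbasis_expand:
  fixes A :: "real ^ 'n ^ 'n"
  assumes "eigenbasis A u a"
  shows "x = (\<Sum>i\<in>UNIV. (x \<bullet> u i) *\<^sub>R u i)"
proof -
  have "x \<bullet> y = (\<Sum>i\<in>UNIV. (x \<bullet> u i) *\<^sub>R u i) \<bullet> y" for y
    using eigenbasis_parseval[OF assms, of x y] by (simp add: inner_sum_left)
  then show ?thesis
    using vector_eq_rdot by metis
qed

section \<open>Matrix exponential and hyperbolic cosine in an eigenbasis\<close>

lemma linear_mult_vec_left: "linear (\<lambda>A :: real ^ 'n ^ 'm. A *v x)"
  by (rule linearI) (simp_all add: matrix_vector_mult_add_rdistrib scaleR_matrix_vector_assoc)

lemma eigenbasis_uminus:
  "eigenbasis A u a \<Longrightarrow> eigenbasis (- A) u (\<lambda>i. - a i)"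
  by (simp add: eigenbasis_def linear_neg[OF linear_mult_vec_left])

lemma eigenbasis_scaleR:
  "eigenbasis A u a \<Longrightarrow> eigenbasis (r *\<^sub>R A) u (\<lambda>i. r * a i)"
  by (simp add: eigenbasis_def scaleR_matrix_vector_assoc[symmetric])

lemma eigenbasis_mat_power:
  assumes "eigenbasis A u a"
  shows "mat_power A k *v u i = (a i ^ k) *\<^sub>R u i"
  using assms
  by (induction k) (simp_all add: eigenbasis_def matrix_vector_mul_assoc[symmetric]
      matrix_vector_mult_scaleR mult.commute)

definition outer :: "real ^ 'n \<Rightarrow> real ^ 'n ^ 'n" where
  "outer v = (\<chi> i j. v $ i * v $ j)"

lemma outer_mult_vec: "outer v *v x = (v \<bullet> x) *\<^sub>R v"
  by (simp add: vec_eq_iff outer_def matrix_vector_mult_def inner_vec_def sum_distrib_left ac_simps)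

lemma trace_outer: "trace (outer v) = v \<bullet> v"
  by (simp add: trace_def outer_def inner_vec_def)

lemma linear_trace: "linear (trace :: real ^ 'n ^ 'n \<Rightarrow> real)"
  by (rule linearI) (simp_all add: trace_def sum.distrib sum_distrib_left)

text \<open>Both sides act alike on the basis \<open>u\<close>. \<open>N\<close> is kept general so
  that every power of \<open>A\<close> can be decomposed over the same basis.\<close>

lemma eigenbasis_spectral_decomposition:
  fixes A :: "real ^ 'n ^ 'n"
  assumes A: "eigenbasis A u a" and N: "\<And>i. N *v u i = g i *\<^sub>R u i"
  shows "N = (\<Sum>i\<in>UNIV. g i *\<^sub>R outer (u i))"
proof -
  have "N *v x = (\<Sum>i\<in>UNIV. g i *\<^sub>R outer (u i)) *v x" for x
  proof -
    have "N *v x = N *v (\<Sum>i\<in>UNIV. (x \<bullet> u i) *\<^sub>R u i)"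
      using eigenbasis_expand[OF A, of x] by simp
    also have "\<dots> = (\<Sum>i\<in>UNIV. g i *\<^sub>R (outer (u i) *v x))"
      by (simp add: linear_sum[OF matrix_vector_mul_linear] matrix_vector_mult_scaleR N
          outer_mult_vec inner_commute mult.commute)
    also have "\<dots> = (\<Sum>i\<in>UNIV. g i *\<^sub>R outer (u i)) *v x"
      by (simp add: linear_sum[OF linear_mult_vec_left] scaleR_matrix_vector_assoc)
    finally show ?thesis .
  qed
  then show ?thesis
    by (simp add: matrix_eq)
qed

text \<open>The matrix series splits into finitely many scalar exponential series, one for each
  eigenvalue; this also shows that the infinite sum in \<open>mat_exp\<close> converges
  here.\<close>

lemma mat_exp_spectral:
  fixes A :: "real ^ 'n ^ 'n"
  assumes A: "eigenbasis A u a"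
  shows "mat_exp A = (\<Sum>i\<in>UNIV. exp (a i) *\<^sub>R outer (u i))"
proof -
  have "(\<lambda>k. (a i ^ k /\<^sub>R fact k) *\<^sub>R outer (u i)) sums (exp (a i) *\<^sub>R outer (u i))" for i
    by (rule bounded_linear.sums[OF bounded_linear_scaleR_left exp_converges])
  then have "(\<lambda>k. \<Sum>i\<in>UNIV. (a i ^ k /\<^sub>R fact k) *\<^sub>R outer (u i)) sums
      (\<Sum>i\<in>UNIV. exp (a i) *\<^sub>R outer (u i))"
    by (rule sums_sum)
  moreover have "(1 / fact k) *\<^sub>R mat_power A k = (\<Sum>i\<in>UNIV. (a i ^ k /\<^sub>R fact k) *\<^sub>R outer (u i))" for k
    unfolding eigenbasis_spectral_decomposition[OF A eigenbasis_mat_power[OF A], of k]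
    by (simp add: scaleR_sum_right divide_inverse)
  ultimately show ?thesis
    unfolding mat_exp_def by (simp add: sums_iff)
qed

lemma trace_mat_cosh:
  fixes A :: "real ^ 'n ^ 'n"
  assumes A: "eigenbasis A u a"
  shows "trace (mat_cosh A) = (\<Sum>i\<in>UNIV. cosh (a i))"
proof -
  have "u i \<bullet> u i = 1" for i
    using A by (simp add: eigenbasis_def)
  then have "trace (mat_exp A) = (\<Sum>i\<in>UNIV. exp (a i))" "trace (mat_exp (- A)) = (\<Sum>i\<in>UNIV. exp (- a i))"
    by (simp_all add: mat_exp_spectral[OF A] mat_exp_spectral[OF eigenbasis_uminus[OF A]]
        linear_sum[OF linear_trace] linear_cmul[OF linear_trace] trace_outer)
  then show ?thesis
    by (simp add: mat_cosh_def linear_add[OF linear_trace] linear_cmul[OF linear_trace]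
        cosh_field_def sum.distrib sum_divide_distrib[symmetric])
qed

section \<open>Perturbation of the trace of \<open>cosh\<close>\<close>

lemma eigenbasis_sum_norm:
  fixes A :: "real ^ 'n ^ 'n"
  assumes "eigenbasis A u a"
  shows "(\<Sum>i\<in>UNIV. (u i \<bullet> x)\<^sup>2) = (norm x)\<^sup>2"
  using eigenbasis_parseval[OF assms, of x x]
  by (simp add: power2_eq_square inner_commute dot_square_norm)

text \<open>With \<open>HA\<close> and \<open>HC\<close> for the traces of
  \<open>B\<^sup>2 cosh A\<close> and \<open>B\<^sup>2 cosh (A + B)\<close>, the Taylor bound leaves
  the remainder \<open>HA / 3 + HC / 6\<close>. Since \<open>HC \<le> 3 * HA\<close>, this is at
  most \<open>5 * HA / 6\<close>, hence at most \<open>HA\<close>.\<close>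

lemma trace_mat_cosh_add_le:
  fixes A B :: "real ^ 'n ^ 'n"
  assumes A: "A \<in> symmetric_mats" and B: "B \<in> symmetric_mats"
    and u: "eigenbasis A u a" and contr: "\<And>x. norm (B *v x) \<le> norm x"
  shows "trace (mat_cosh (A + B)) \<le> trace (mat_cosh A)
    + (\<Sum>i\<in>UNIV. sinh (a i) * (u i \<bullet> (B *v u i)))
    + (\<Sum>i\<in>UNIV. cosh (a i) * (u i \<bullet> (mat_power B 2 *v u i)))"
proof -
  have "A + B \<in> symmetric_mats"
    by (rule symmetric_mats_add[OF A B])
  then obtain w c where w: "eigenbasis (A + B) w c"
    by (rule symmetric_mats_eigenbasis)
  define p where "p i j = u i \<bullet> w j" for i j
  define q where "q i j = u i \<bullet> (B *v w j)" for i j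
  define r where "r i j = u i \<bullet> (B *v (B *v w j))" for i j
  have sB: "x \<bullet> (B *v y) = (B *v x) \<bullet> y" for x y
    by (rule symmetric_mats_inner[OF B])
  have B2: "x \<bullet> (B *v (B *v x)) = (norm (B *v x))\<^sup>2" for x
    by (simp add: sB[of x "B *v x"] dot_square_norm)
  have q': "q i j = (B *v u i) \<bullet> w j" and r': "r i j = (B *v (B *v u i)) \<bullet> w j" for i j
    by (simp_all add: q_def r_def sB)
  have n1: "norm (u i) = 1" "norm (w i) = 1" for i
    using u w by (simp_all add: eigenbasis_def norm_eq_1)
  have pq: "q i j = (c j - a i) * p i j" for i j
  proof -
    have "A *v u i = a i *\<^sub>R u i" "B *v w j = c j *\<^sub>R w j - A *v w j"
      using u w by (auto simp: eigenbasis_def matrix_vector_mult_add_rdistrib algebra_simps)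
    then show ?thesis
      by (simp add: q_def p_def inner_diff_right symmetric_mats_inner[OF A] left_diff_distrib)
  qed
  \<comment> \<open>The weights \<open>(p i j)\<^sup>2\<close> are doubly stochastic; the row and
    column sums that follow are likewise Parseval identities in the two bases.\<close>
  have p_row: "(\<Sum>j\<in>UNIV. (p i j)\<^sup>2) = 1" and p_col: "(\<Sum>j\<in>UNIV. (p j i)\<^sup>2) = 1" for i
    using eigenbasis_sum_norm[OF w, of "u i"] eigenbasis_sum_norm[OF u, of "w i"]
    by (simp_all add: p_def n1 inner_commute)
  have q_row: "(\<Sum>j\<in>UNIV. (q i j)\<^sup>2) = (norm (B *v u i))\<^sup>2"
    and q_col: "(\<Sum>j\<in>UNIV. (q j i)\<^sup>2) = (norm (B *v w i))\<^sup>2" for i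
    using eigenbasis_sum_norm[OF w, of "B *v u i"] eigenbasis_sum_norm[OF u, of "B *v w i"]
    unfolding q_def[symmetric] by (simp_all add: q' inner_commute)
  \<comment> \<open>Here contractivity enters: a second application of \<open>B\<close> does not
    increase the norm.\<close>
  have r_row: "(\<Sum>j\<in>UNIV. (r i j)\<^sup>2) \<le> (norm (B *v u i))\<^sup>2"
    and r_col: "(\<Sum>j\<in>UNIV. (r j i)\<^sup>2) \<le> (norm (B *v w i))\<^sup>2" for i
    using eigenbasis_sum_norm[OF w, of "B *v (B *v u i)"] eigenbasis_sum_norm[OF u, of "B *v (B *v w i)"]
      power_mono[OF contr[of "B *v u i"], of 2] power_mono[OF contr[of "B *v w i"], of 2]
    unfolding r_def[symmetric] by (simp_all add: r' inner_commute)
  have pr_row: "(\<Sum>j\<in>UNIV. p i j * r i j) = (norm (B *v u i))\<^sup>2"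
    and pr_col: "(\<Sum>j\<in>UNIV. p j i * r j i) = (norm (B *v w i))\<^sup>2" for i
    using eigenbasis_parseval[OF w, of "u i" "B *v (B *v u i)"]
      eigenbasis_parseval[OF u, of "w i" "B *v (B *v w i)"] B2[of "u i"] B2[of "w i"]
    unfolding r_def[symmetric] by (simp_all add: p_def r' inner_commute)
  have pq_row: "(\<Sum>j\<in>UNIV. p i j * q i j) = u i \<bullet> (B *v u i)" for i
    using eigenbasis_parseval[OF w, of "u i" "B *v u i"]
    by (simp add: p_def q' inner_commute)
  define HA where "HA = (\<Sum>i\<in>UNIV. cosh (a i) * (norm (B *v u i))\<^sup>2)"
  define HC where "HC = (\<Sum>j\<in>UNIV. cosh (c j) * (norm (B *v w j))\<^sup>2)"
  have dbl_row: "(\<Sum>i\<in>UNIV. \<Sum>j\<in>UNIV. h i * s i j) = (\<Sum>i\<in>UNIV. h i * (\<Sum>j\<in>UNIV. s i j))"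
    for h :: "'n \<Rightarrow> real" and s :: "'n \<Rightarrow> 'n \<Rightarrow> real"
    by (simp add: sum_distrib_left)
  have dbl_col: "(\<Sum>i\<in>UNIV. \<Sum>j\<in>UNIV. h j * s i j) = (\<Sum>j\<in>UNIV. h j * (\<Sum>i\<in>UNIV. s i j))"
    for h :: "'n \<Rightarrow> real" and s :: "'n \<Rightarrow> 'n \<Rightarrow> real"
    by (subst sum.swap) (simp add: sum_distrib_left)

  text \<open>
    Summing \<open>cosh_taylor_bound\<close> with the weights \<open>(p i j)\<^sup>2\<close> turns, by \<open>pq\<close>, every factor
    \<open>c j - a i\<close> into the form \<open>q\<close> of \<open>B\<close>.
  \<close>
  have "(\<Sum>j\<in>UNIV. cosh (c j)) = (\<Sum>i\<in>UNIV. \<Sum>j\<in>UNIV. cosh (c j) * (p i j)\<^sup>2)"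
    unfolding dbl_col p_col by simp
  also have "\<dots> \<le> (\<Sum>i\<in>UNIV. \<Sum>j\<in>UNIV. cosh (a i) * (p i j)\<^sup>2 + sinh (a i) * (p i j * q i j)
      + (cosh (a i) / 3 * (q i j)\<^sup>2 + cosh (c j) / 6 * (q i j)\<^sup>2))"
  proof (intro sum_mono)
    fix i j
    have "cosh (c j) * (p i j)\<^sup>2 \<le>
      (cosh (a i) + (c j - a i) * sinh (a i) + (c j - a i)\<^sup>2 * (2 * cosh (a i) + cosh (c j)) / 6) * (p i j)\<^sup>2"
      by (intro mult_right_mono cosh_taylor_bound) simp
    also have "\<dots> = cosh (a i) * (p i j)\<^sup>2 + sinh (a i) * (p i j * q i j)
      + (cosh (a i) / 3 * (q i j)\<^sup>2 + cosh (c j) / 6 * (q i j)\<^sup>2)"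
      by (simp add: pq power_mult_distrib field_simps power2_eq_square)
    finally show "cosh (c j) * (p i j)\<^sup>2 \<le> cosh (a i) * (p i j)\<^sup>2 + sinh (a i) * (p i j * q i j)
      + (cosh (a i) / 3 * (q i j)\<^sup>2 + cosh (c j) / 6 * (q i j)\<^sup>2)" .
  qed
  also have "\<dots> = (\<Sum>i\<in>UNIV. cosh (a i)) + (\<Sum>i\<in>UNIV. sinh (a i) * (u i \<bullet> (B *v u i))) + (HA / 3 + HC / 6)"
    unfolding sum.distrib dbl_row dbl_col p_row pq_row q_row q_col HA_def HC_def sum_divide_distrib
    by simp
  finally have first: "(\<Sum>j\<in>UNIV. cosh (c j)) \<le> (\<Sum>i\<in>UNIV. cosh (a i))
    + (\<Sum>i\<in>UNIV. sinh (a i) * (u i \<bullet> (B *v u i))) + (HA / 3 + HC / 6)" .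

  \<comment> \<open>The products \<open>p i j * r i j\<close> have row sums that yield
    \<open>HA\<close> and column sums that yield \<open>HC\<close>, so the difference becomes one
    double sum over \<open>cosh (c j) - cosh (a i)\<close>. Its bound supplies a factor
    \<open>\<bar>c j - a i\<bar>\<close>, which \<open>pq\<close> absorbs by turning
    \<open>p\<close> into \<open>q\<close>.\<close>
  have "HC - HA = (\<Sum>i\<in>UNIV. \<Sum>j\<in>UNIV. cosh (c j) * (p i j * r i j))
      - (\<Sum>i\<in>UNIV. \<Sum>j\<in>UNIV. cosh (a i) * (p i j * r i j))"
    unfolding dbl_row dbl_col pr_row pr_col HA_def HC_def ..
  also have "\<dots> = (\<Sum>i\<in>UNIV. \<Sum>j\<in>UNIV. (cosh (c j) - cosh (a i)) * (p i j * r i j))"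
    by (simp add: sum_subtractf left_diff_distrib)
  also have "\<dots> \<le> (\<Sum>i\<in>UNIV. \<Sum>j\<in>UNIV. (cosh (a i) / 4 * (q i j)\<^sup>2 + cosh (c j) / 4 * (q i j)\<^sup>2)
      + (cosh (a i) / 4 * (r i j)\<^sup>2 + cosh (c j) / 4 * (r i j)\<^sup>2))"
  proof (intro sum_mono)
    fix i j
    have "(cosh (c j) - cosh (a i)) * (p i j * r i j) \<le> \<bar>cosh (c j) - cosh (a i)\<bar> * \<bar>p i j * r i j\<bar>"
      by (metis abs_ge_self abs_mult)
    also have "\<dots> \<le> (\<bar>c j - a i\<bar> * (cosh (a i) + cosh (c j)) / 2) * \<bar>p i j * r i j\<bar>"
      by (intro mult_right_mono abs_cosh_diff_le) simp
    also have "\<dots> = (cosh (a i) + cosh (c j)) / 2 * \<bar>q i j * r i j\<bar>"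
      by (simp add: pq abs_mult)
    also have "\<dots> \<le> (cosh (a i) + cosh (c j)) / 2 * (((q i j)\<^sup>2 + (r i j)\<^sup>2) / 2)"
    proof (rule mult_left_mono)
      have "0 \<le> (\<bar>q i j\<bar> - \<bar>r i j\<bar>)\<^sup>2"
        by simp
      then show "\<bar>q i j * r i j\<bar> \<le> ((q i j)\<^sup>2 + (r i j)\<^sup>2) / 2"
        by (simp add: power2_diff abs_mult)
    qed (simp add: add_nonneg_nonneg)
    also have "\<dots> = (cosh (a i) / 4 * (q i j)\<^sup>2 + cosh (c j) / 4 * (q i j)\<^sup>2)
      + (cosh (a i) / 4 * (r i j)\<^sup>2 + cosh (c j) / 4 * (r i j)\<^sup>2)"
      by (simp add: field_simps)
    finally show "(cosh (c j) - cosh (a i)) * (p i j * r i j) \<le> \<dots>" .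
  qed
  \<comment> \<open>The squares of \<open>q\<close> and of \<open>r\<close> contribute
    \<open>HA / 4 + HC / 4\<close> each, so \<open>HC - HA\<close> is at most half of
    \<open>HA + HC\<close>.\<close>
  also have "\<dots> \<le> (HA / 4 + HC / 4) + (HA / 4 + HC / 4)"
  proof -
    have HA: "HA / 4 = (\<Sum>i\<in>UNIV. cosh (a i) / 4 * (norm (B *v u i))\<^sup>2)"
      and HC: "HC / 4 = (\<Sum>j\<in>UNIV. cosh (c j) / 4 * (norm (B *v w j))\<^sup>2)"
      by (simp_all add: HA_def HC_def sum_divide_distrib)
    show ?thesis
      unfolding sum.distrib dbl_row dbl_col q_row q_col HA HC
      by (intro add_mono sum_mono mult_left_mono r_row r_col order_refl) auto
  qed
  finally have "HC \<le> 3 * HA"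
    by simp
  moreover have "HA = (\<Sum>i\<in>UNIV. cosh (a i) * (u i \<bullet> (mat_power B 2 *v u i)))"
    by (simp add: HA_def numeral_2_eq_2 matrix_vector_mul_assoc[symmetric] B2)
  moreover have "HA \<ge> 0"
    by (simp add: HA_def sum_nonneg)
  ultimately show ?thesis
    unfolding trace_mat_cosh[OF u] trace_mat_cosh[OF w] using first by linarith
qed

section \<open>One greedy step by averaging\<close>

lemma bounded_linear_quadratic_form_sum:
  fixes g :: "'n :: finite \<Rightarrow> real"
  shows "bounded_linear (\<lambda>N :: real ^ 'n ^ 'n. \<Sum>i\<in>UNIV. g i * (u i \<bullet> (N *v u i)))"
  by (rule linear_conv_bounded_linear[THEN iffD1], rule linearI)
    (simp_all add: matrix_vector_mult_add_rdistrib scaleR_matrix_vector_assoc[symmetric]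
      inner_add_right sum.distrib sum_distrib_left algebra_simps)

lemma norm_mult_vec_le_opnorm:
  fixes A :: "real ^ 'n ^ 'n"
  shows "norm (A *v x) \<le> opnorm A * norm x"
  by (rule onorm[OF matrix_vector_mul_bounded_linear])

lemma mat_power_2_scaleR:
  fixes A :: "real ^ 'n ^ 'n"
  shows "mat_power (r *\<^sub>R A) 2 = r\<^sup>2 *\<^sub>R mat_power A 2"
  by (simp add: numeral_2_eq_2 scalar_matrix_assoc matrix_scalar_ac flip: scaleR_scaleR)

text \<open>A lower bound \<open>y\<close> for all choices is also one for their average over
  \<open>Y\<close>. In the averaged perturbation bound the linear term vanishes and the quadratic
  term is controlled by the variance.\<close>

lemma (in prob_space) trace_mat_cosh_greedy_step:
  fixes g :: "nat \<Rightarrow> real ^ 'n ^ 'n" and A :: "real ^ 'n ^ 'n"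
  assumes A: "A \<in> symmetric_mats" and K: "finite K"
    and g: "\<And>k. k \<in> K \<Longrightarrow> g k \<in> symmetric_mats" "\<And>k. k \<in> K \<Longrightarrow> opnorm (g k) \<le> \<gamma>"
    and Y: "Y \<in> measurable M (count_space K)"
    and mean: "expectation (\<lambda>\<omega>. g (Y \<omega>)) = 0"
    and var: "opnorm (expectation (\<lambda>\<omega>. mat_power (g (Y \<omega>)) 2)) \<le> v"
    and \<theta>: "0 \<le> \<theta>" "\<theta> * \<gamma> \<le> 1"
    and min: "\<And>k. k \<in> K \<Longrightarrow> y \<le> trace (mat_cosh (A + \<theta> *\<^sub>R g k))"
  shows "y \<le> (1 + \<theta>\<^sup>2 * v) * trace (mat_cosh A)"
proof -
  obtain u a where u: "eigenbasis A u a"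
    using symmetric_mats_eigenbasis[OF A] .
  define L where "L N = (\<Sum>i\<in>UNIV. sinh (a i) * (u i \<bullet> (N *v u i)))" for N :: "real ^ 'n ^ 'n"
  define Q where "Q N = (\<Sum>i\<in>UNIV. cosh (a i) * (u i \<bullet> (N *v u i)))" for N :: "real ^ 'n ^ 'n"
  have L: "bounded_linear L" and Q: "bounded_linear Q"
    unfolding L_def Q_def by (rule bounded_linear_quadratic_form_sum)+
  have bound: "y \<le> trace (mat_cosh A) + \<theta> * L (g k) + \<theta>\<^sup>2 * Q (mat_power (g k) 2)" if k: "k \<in> K" for k
  proof -
    have "norm ((\<theta> *\<^sub>R g k) *v x) \<le> norm x" for x
    proof -
      have "norm ((\<theta> *\<^sub>R g k) *v x) \<le> \<theta> * (opnorm (g k) * norm x)"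
        using mult_left_mono[OF norm_mult_vec_le_opnorm \<theta>(1), of "g k" x] \<theta>(1)
        by (simp add: scaleR_matrix_vector_assoc[symmetric])
      also have "\<dots> \<le> \<theta> * (\<gamma> * norm x)"
        using \<theta> g(2)[OF k] by (intro mult_left_mono mult_right_mono) auto
      also have "\<dots> \<le> norm x"
        using mult_right_mono[OF \<theta>(2) norm_ge_zero, of x] by (simp add: mult.assoc)
      finally show ?thesis .
    qed
    then have "trace (mat_cosh (A + \<theta> *\<^sub>R g k)) \<le> trace (mat_cosh A) + L (\<theta> *\<^sub>R g k)
        + Q (mat_power (\<theta> *\<^sub>R g k) 2)"
      unfolding L_def Q_def by (intro trace_mat_cosh_add_le A symmetric_mats_scaleR g(1) k u)
    also have "\<dots> = trace (mat_cosh A) + \<theta> * L (g k) + \<theta>\<^sup>2 * Q (mat_power (g k) 2)"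
      unfolding mat_power_2_scaleR by (simp add: linear_cmul bounded_linear.linear L Q)
    finally show ?thesis
      using min[OF k] by linarith
  qed
  have YK: "Y \<omega> \<in> K" if "\<omega> \<in> space M" for \<omega>
    using measurable_space[OF Y that] by simp
  \<comment> \<open>\<open>Y\<close> takes values in the finite set \<open>K\<close>, so any
    function of it is bounded and measurable.\<close>
  have int: "integrable M (\<lambda>\<omega>. h (Y \<omega>))" for h :: "nat \<Rightarrow> real ^ 'n ^ 'n"
  proof (rule integrable_const_bound[where B = "\<Sum>k\<in>K. norm (h k)"])
    show "AE \<omega> in M. norm (h (Y \<omega>)) \<le> (\<Sum>k\<in>K. norm (h k))"
      using YK K by (intro AE_I2 member_le_sum) auto
    show "(\<lambda>\<omega>. h (Y \<omega>)) \<in> borel_measurable M"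
      using measurable_compose[OF Y, of h borel] by simp
  qed
  have intL: "integrable M (\<lambda>\<omega>. L (g (Y \<omega>)))" "expectation (\<lambda>\<omega>. L (g (Y \<omega>))) = 0"
    using integrable_bounded_linear[OF L int, of g] integral_bounded_linear[OF L int, of g]
    by (simp_all add: mean linear_0 bounded_linear.linear L)
  define V where "V = expectation (\<lambda>\<omega>. mat_power (g (Y \<omega>)) 2)"
  have intQ: "integrable M (\<lambda>\<omega>. Q (mat_power (g (Y \<omega>)) 2))"
    "expectation (\<lambda>\<omega>. Q (mat_power (g (Y \<omega>)) 2)) = Q V"
    using integrable_bounded_linear[OF Q int, of "\<lambda>k. mat_power (g k) 2"]
      integral_bounded_linear[OF Q int, of "\<lambda>k. mat_power (g k) 2"]
    by (simp_all add: V_def)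
  have "y = expectation (\<lambda>\<omega>. y)"
    by (simp add: prob_space)
  also have "\<dots> \<le> expectation (\<lambda>\<omega>. trace (mat_cosh A) + \<theta> * L (g (Y \<omega>)) + \<theta>\<^sup>2 * Q (mat_power (g (Y \<omega>)) 2))"
    using intL(1) intQ(1) by (intro integral_mono bound YK) auto
  also have "\<dots> = trace (mat_cosh A) + \<theta>\<^sup>2 * Q V"
    using intL intQ by (simp add: prob_space)
  \<comment> \<open>The weights \<open>cosh (a i)\<close> are positive, and Cauchy-Schwarz bounds
    each form \<open>u i \<bullet> (V *v u i)\<close> by \<open>opnorm V\<close>.\<close>
  also have "Q V \<le> v * trace (mat_cosh A)"
    unfolding Q_def trace_mat_cosh[OF u] sum_distrib_left
  proof (rule sum_mono)
    fix i
    have "norm (u i) = 1"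
      using u by (simp add: eigenbasis_def norm_eq_1)
    then have "u i \<bullet> (V *v u i) \<le> opnorm V"
      using norm_cauchy_schwarz[of "u i" "V *v u i"] norm_mult_vec_le_opnorm[of V "u i"] by simp
    then show "cosh (a i) * (u i \<bullet> (V *v u i)) \<le> v * cosh (a i)"
      using var by (simp add: V_def mult.commute)
  qed
  then have "trace (mat_cosh A) + \<theta>\<^sup>2 * Q V \<le> trace (mat_cosh A) + \<theta>\<^sup>2 * (v * trace (mat_cosh A))"
    by (intro add_left_mono mult_left_mono) auto
  finally show ?thesis
    by (simp add: algebra_simps)
qed

section \<open>Initial value, recovery of the norm, and conclusion\<close>

lemma trace_mat_cosh_0: "trace (mat_cosh (0 :: real ^ 'n ^ 'n)) = CARD('n)"
proof -
  have "(0 :: real ^ 'n ^ 'n) \<in> symmetric_mats"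
    by (simp add: symmetric_mats_def transpose_def vec_eq_iff)
  then obtain u a where u: "eigenbasis (0 :: real ^ 'n ^ 'n) u a"
    by (rule symmetric_mats_eigenbasis)
  have "a i = 0" for i
  proof -
    have "a i *\<^sub>R u i = 0" "u i \<bullet> u i = 1"
      using u by (simp_all add: eigenbasis_def)
    then show ?thesis
      by auto
  qed
  then show ?thesis
    by (simp add: trace_mat_cosh[OF u])
qed

text \<open>The operator norm is at most the largest \<open>\<bar>a k\<bar>\<close>,
  \<open>exp \<bar>a k\<bar>\<close> is one of the two summands of \<open>2 * cosh (a k)\<close>,
  and the other eigenvalues add positive terms to the trace.\<close>

lemma exp_opnorm_le_trace_mat_cosh:
  fixes A :: "real ^ 'n ^ 'n"
  assumes A: "A \<in> symmetric_mats"
  shows "exp (opnorm A) \<le> 2 * trace (mat_cosh A)"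
proof -
  obtain u a where u: "eigenbasis A u a"
    using symmetric_mats_eigenbasis[OF A] .
  define l where "l = Max (range (\<lambda>i. \<bar>a i\<bar>))"
  have "l \<in> range (\<lambda>i. \<bar>a i\<bar>)"
    unfolding l_def by (rule Max_in) auto
  then obtain k where k: "l = \<bar>a k\<bar>"
    by blast
  have l: "\<bar>a i\<bar> \<le> l" for i
    unfolding l_def by (rule Max_ge) auto
  have "opnorm A \<le> l"
  proof (rule onorm_bound)
    show "0 \<le> l"
      by (simp add: k)
    fix x
    have "(norm (A *v x))\<^sup>2 = (\<Sum>i\<in>UNIV. (a i)\<^sup>2 * (u i \<bullet> x)\<^sup>2)"
      using u by (simp add: eigenbasis_sum_norm[OF u, symmetric] symmetric_mats_inner[OF A]
          eigenbasis_def power_mult_distrib)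
    also have "\<dots> \<le> (\<Sum>i\<in>UNIV. l\<^sup>2 * (u i \<bullet> x)\<^sup>2)"
      using l by (intro sum_mono mult_right_mono) (auto simp: abs_le_square_iff[symmetric] k)
    also have "\<dots> = (l * norm x)\<^sup>2"
      by (simp add: eigenbasis_sum_norm[OF u] sum_distrib_left[symmetric] power_mult_distrib)
    finally show "norm (A *v x) \<le> l * norm x"
      by (rule power2_le_imp_le) (simp add: k)
  qed
  then have "exp (opnorm A) \<le> exp \<bar>a k\<bar>"
    by (simp add: k)
  also have "\<dots> \<le> 2 * cosh (a k)"
    by (simp add: cosh_field_def abs_if add_increasing add_increasing2)
  also have "cosh (a k) \<le> (\<Sum>i\<in>UNIV. cosh (a i))"
    by (intro member_le_sum) auto
  finally show ?thesis
    by (simp add: trace_mat_cosh[OF u])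
qed

theorem theorem4:
  fixes f :: "nat \<Rightarrow> nat \<Rightarrow> real ^ 'n ^ 'n"
    and M :: "'w measure"
    and X :: "nat \<Rightarrow> 'w \<Rightarrow> nat"
    and x :: "nat \<Rightarrow> nat"
    and m t :: nat
    and \<gamma> \<rho> \<epsilon> \<theta> :: real
  assumes "m \<ge> 1" and "t \<ge> 1"
    and "\<gamma> > 0" and "\<rho> \<ge> 0" and "0 < \<epsilon>" and "\<epsilon> < 1"
    and "\<And>j i. j \<ge> 1 \<Longrightarrow> i \<in> {1..m} \<Longrightarrow> f j i \<in> symmetric_mats"
    and "\<And>j i. j \<ge> 1 \<Longrightarrow> i \<in> {1..m} \<Longrightarrow> opnorm (f j i) \<le> \<gamma>"
    and "prob_space M"
    and "prob_space.indep_vars M (\<lambda>_. count_space {1..m}) X {1..}"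
    and "\<And>j. j \<ge> 1 \<Longrightarrow> prob_space.expectation M (\<lambda>\<omega>. f j (X j \<omega>)) = 0"
    and "\<And>j. j \<ge> 1 \<Longrightarrow>
           opnorm (prob_space.expectation M (\<lambda>\<omega>. mat_power (f j (X j \<omega>)) 2)) \<le> \<rho>\<^sup>2"
    and "\<theta> = \<epsilon> / \<gamma>"
    and "\<And>i. i \<in> {1..t} \<Longrightarrow>
           is_arg_min
             (\<lambda>k. trace (mat_cosh (\<theta> *\<^sub>R (\<Sum>j=1..i-1. f j (x j)) + \<theta> *\<^sub>R f i k)))
             (\<lambda>k. k \<in> {1..m}) (x i)"
  shows "opnorm ((1 / real t) *\<^sub>R (\<Sum>j=1..t. f j (x j)))
           \<le> \<gamma> * ln (2 * real CARD('n)) / (real t * \<epsilon>) + \<epsilon> * \<rho>\<^sup>2 / \<gamma>"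
proof -
  interpret prob_space M by fact
  note sym = assms(7) and norm = assms(8) and mean = assms(11) and var = assms(12) and argmin = assms(14)
  \<comment> \<open>\<open>\<theta> * \<gamma>\<close> equals \<open>\<epsilon>\<close>, which makes
    every \<open>\<theta> *\<^sub>R f j i\<close> with admissible indices a contraction.\<close>
  have \<theta>: "\<theta> > 0" "\<theta> * \<gamma> \<le> 1"
    using assms(3,5,6,13) by auto
  define S where "S i = (\<Sum>j=1..i. f j (x j))" for i
  have x: "x i \<in> {1..m}" if "i \<in> {1..t}" for i
    using argmin[OF that] by (simp add: is_arg_min_def)
  have S: "\<theta> *\<^sub>R S i \<in> symmetric_mats" if "i \<le> t" for i
    unfolding S_def using that x by (intro symmetric_mats_scaleR symmetric_mats_sum sym) auto
  have "trace (mat_cosh (\<theta> *\<^sub>R S i)) \<le> (1 + \<theta>\<^sup>2 * \<rho>\<^sup>2) ^ i * CARD('n)" if "i \<le> t" for i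
    using that
  proof (induction i)
    case 0
    then show ?case
      by (simp add: S_def trace_mat_cosh_0)
  next
    case (Suc i)
    have "trace (mat_cosh (\<theta> *\<^sub>R S i + \<theta> *\<^sub>R f (Suc i) (x (Suc i))))
        \<le> (1 + \<theta>\<^sup>2 * \<rho>\<^sup>2) * trace (mat_cosh (\<theta> *\<^sub>R S i))"
    proof (rule trace_mat_cosh_greedy_step[where K = "{1..m}" and Y = "X (Suc i)"])
      show "X (Suc i) \<in> measurable M (count_space {1..m})"
        using assms(10) by (auto simp: indep_vars_def)
      show "trace (mat_cosh (\<theta> *\<^sub>R S i + \<theta> *\<^sub>R f (Suc i) (x (Suc i))))
          \<le> trace (mat_cosh (\<theta> *\<^sub>R S i + \<theta> *\<^sub>R f (Suc i) k))" if "k \<in> {1..m}" for k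
        \<comment> \<open>At index \<open>Suc i\<close> the sum in the minimized function ends at
          \<open>Suc i - 1\<close>, so it is \<open>S i\<close>.\<close>
        using argmin[of "Suc i"] Suc.prems that by (auto simp: is_arg_min_def S_def not_less)
    qed (use S Suc.prems sym norm mean var \<theta> in auto)
    also have "\<dots> \<le> (1 + \<theta>\<^sup>2 * \<rho>\<^sup>2) * ((1 + \<theta>\<^sup>2 * \<rho>\<^sup>2) ^ i * CARD('n))"
      using Suc by (intro mult_left_mono) (auto intro: add_nonneg_nonneg)
    finally show ?case
      by (simp add: S_def scaleR_add_right)
  qed
  then have "2 * trace (mat_cosh (\<theta> *\<^sub>R S t)) \<le> 2 * CARD('n) * (1 + \<theta>\<^sup>2 * \<rho>\<^sup>2) ^ t"
    by (simp add: mult.commute)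
  \<comment> \<open>From \<open>1 + z \<le> exp z\<close>; the growth factors become an exponent
    linear in \<open>t\<close>, ready for the logarithm.\<close>
  also have "\<dots> \<le> 2 * CARD('n) * exp (\<theta>\<^sup>2 * \<rho>\<^sup>2) ^ t"
    by (intro mult_left_mono power_mono) (auto intro: add_nonneg_nonneg)
  also have "\<dots> = exp (ln (2 * CARD('n)) + t * (\<theta>\<^sup>2 * \<rho>\<^sup>2))"
    by (simp add: exp_add exp_of_nat_mult)
  finally have "exp (opnorm (\<theta> *\<^sub>R S t)) \<le> exp (ln (2 * CARD('n)) + t * (\<theta>\<^sup>2 * \<rho>\<^sup>2))"
    using exp_opnorm_le_trace_mat_cosh[OF S[of t]] by linarith
  then have "opnorm (\<theta> *\<^sub>R S t) \<le> ln (2 * CARD('n)) + t * (\<theta>\<^sup>2 * \<rho>\<^sup>2)"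
    by simp
  moreover have opnorm_scaleR: "opnorm (r *\<^sub>R N) = \<bar>r\<bar> * opnorm N" for r and N :: "real ^ 'n ^ 'n"
    using onorm_scaleR[OF matrix_vector_mul_bounded_linear, of r N]
    by (simp add: scaleR_matrix_vector_assoc)
  ultimately have "opnorm (S t) \<le> (ln (2 * CARD('n)) + t * (\<theta>\<^sup>2 * \<rho>\<^sup>2)) / \<theta>"
    using \<theta> by (simp add: field_simps)
  from divide_right_mono[OF this, of "real t"]
  have "opnorm ((1 / t) *\<^sub>R S t) \<le> (ln (2 * CARD('n)) + t * (\<theta>\<^sup>2 * \<rho>\<^sup>2)) / \<theta> / t"
    by (simp add: opnorm_scaleR)
  \<comment> \<open>Division by \<open>\<theta> * t\<close> leaves
    \<open>\<theta> * \<rho>\<^sup>2\<close> as second term, which is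
    \<open>\<epsilon> * \<rho>\<^sup>2 / \<gamma>\<close>.\<close>
  also have "\<dots> = \<gamma> * ln (2 * real CARD('n)) / (real t * \<epsilon>) + \<epsilon> * \<rho>\<^sup>2 / \<gamma>"
    using assms(2,3,5) unfolding assms(13) by (simp add: field_simps power2_eq_square)
  finally show ?thesis
    unfolding S_def .
qed

end
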